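(* Let $f(x)=\frac1N\sum_{i=1}^N\phi_i(x)$ with $f\in C^2(\mathbb{R}^n)$ bounded below by $f_{\mathrm{low}}$. Suppose that for any $x\in\mathbb{R}^n$ there exists $\kappa_\phi(x)\ge0$ with $\max_{i\in\{1,\dots,N\}}\|\nabla^2\phi_i(x)\|\le\kappa_\phi(x)$, and that $\sup_{x\in\mathbb{R}^n}\kappa_\phi(x)\le\overline\kappa_\phi$ for some $\overline\kappa_\phi\ge0$. Consider the algorithm described in the context with subsampled Hessian approximations $$B_k=\frac{1}{|\mathcal D_k|}\sum_{i\in\mathcal D_k}\nabla^2\phi_i(x_k),\qquad \emptyset\neq\mathcal D_k\subset\{1,\dots,N\},$$ and suppose that the steps satisfy the Cauchy condition $m(x_k,s_k,\sigma_k)\le m(x_k,s_k^C,\sigma_k)$ for all $k\ge0$, where $$s_k^C=-\alpha_k^C\nabla f(x_k),\qquad\alpha_k^C=\operatorname*{argmin}_{a\ge0}\,m(x_k,-a\nabla f(x_k),\sigma_k).$$ No accuracy requirement on $\|\nabla^2f(x_k)-B_k\|$ is assumed. Then: (i) Given $\epsilon>0$, the algorithm takes at most $O(\epsilon^{-2})$ successful iterations to satisfy $\|\nabla f(x_k)\|<\epsilon$. (ii) $\|\nabla f(x_k)\|\to0$ as $k\to\infty$, and therefore all the accumulation points of the sequence $\{x_k\}$, if any, are first-order stationary points. (iii) If $\{x_{k_i}\}$ is a subsequence of iterates converging to some $x^*$ such that $\nabla^2f(x^* )$ is positive definite, then $x_k\to x^*$ as $k\to\infty$.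
   Context: $\|\cdot\|$ is the Euclidean vector norm and the induced matrix norm. The $\phi_i:\mathbb{R}^n\to\mathbb{R}$ are twice differentiable. Let $$T_2(x_k,s)=f(x_k)+\nabla f(x_k)^Ts+\tfrac12 s^TB_ks,\quad m(x_k,s,\sigma_k)=T_2(x_k,s)+\tfrac{\sigma_k}{3}\|s\|^3,\quad \rho_k=\frac{f(x_k)-f(x_k+s_k)}{T_2(x_k,0)-T_2(x_k,s_k)} .$$ ALGORITHM (ARC with dynamic Hessian accuracy). For item (i) the algorithm is stopped once the gradient tolerance is met; for items (ii) and (iii) the termination test is disregarded so that infinite sequences are generated. Step 0. Given $x_0\in\mathbb{R}^n$, $\sigma_0>0$, and parameters $0<\theta<1$, $\alpha\in[0,\frac23)$, $\sigma_{\min}\in(0,\sigma_0]$, $0<\eta_1\le\eta_2<\frac{2-3\alpha}{2}$, $0<\gamma_1<1<\gamma_2<\gamma_3$, $C>0$. Set $k=0$, $C_0=C$, flag $=1$. Step 2. Choose $\mathcal D_k$ and compute $B_k$ as in the claim. (In the algorithm the sample is intended to give $\|\nabla^2f(x_k)-B_k\|\le C_k$, but this inequality is not assumed to hold in this result.) Step 3. Choose $\theta_k\le\theta$ and compute $s_k$ with $m(x_k,s_k,\sigma_k)<m(x_k,0,\sigma_k)$ and $\|\nabla_s m(x_k,s_k,\sigma_k)\|\le\theta_k\|\nabla f(x_k)\|$. Step 4. If $\|s_k\|<1$ and flag $=1$ and $C>\alpha(1-\theta)\|\nabla f(x_k)\|$: set $x_{k+1}=x_k$, $\sigma_{k+1}=\sigma_k$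 (unsuccessful iteration), $C_{k+1}=\alpha(1-\theta)\|\nabla f(x_k)\|$, flag $=0$, increment $k$ and go to Step 2. Step 5. Compute $\rho_k$. If $\rho_k\ge\eta_1$ (successful iteration): set $x_{k+1}=x_k+s_k$; choose $\sigma_{k+1}\in[\max(\sigma_{\min},\gamma_1\sigma_k),\sigma_k]$ if $\rho_k\ge\eta_2$, $\sigma_{k+1}\in[\sigma_k,\gamma_2\sigma_k]$ if $\rho_k\in[\eta_1,\eta_2)$; if $\|s_k\|\ge1$ set $C_{k+1}=C$, flag $=1$, otherwise set $C_{k+1}=\alpha(1-\theta)\|\nabla f(x_{k+1})\|$, flag $=0$; increment $k$ and go to Step 2. If $\rho_k<\eta_1$ (unsuccessful iteration): set $x_{k+1}=x_k$, choose $\sigma_{k+1}\in[\gamma_2\sigma_k,\gamma_3\sigma_k]$, set $C_{k+1}=C_k$, $B_{k+1}=B_k$, increment $k$ and go to Step 3. The $O(\epsilon^{-2})$ bound is for small $\epsilon$, with a constant independent of $\epsilon$. *)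

theory Defs
  imports "HOL-Analysis.Analysis" "HOL-Library.Extended_Nat" "HOL-Library.Landau_Symbols"
begin

definition grad :: "(real^'n \<Rightarrow> real) \<Rightarrow> real^'n \<Rightarrow> real^'n" where
  "grad f x = (THE g. GDERIV f x :> g)"

definition hessian :: "(real^'n \<Rightarrow> real) \<Rightarrow> real^'n \<Rightarrow> real^'n^'n" where
  "hessian f x = jacobian (grad f) (at x)"

definition twice_differentiable :: "(real^'n \<Rightarrow> real) \<Rightarrow> bool" where
  "twice_differentiable f \<longleftrightarrow>
     (\<forall>x. f differentiable (at x)) \<and> (\<forall>x. grad f differentiable (at x))"

definition C2 :: "(real^'n \<Rightarrow> real) \<Rightarrow> bool" where
  "C2 f \<longleftrightarrow> twice_differentiable f \<and> continuous_on UNIV (hessian f)"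

text \<open>The matrix norm induced by the Euclidean norm.  The type-class norm of
  \<^typ>\<open>real^'n^'n\<close> is the Frobenius norm instead.\<close>

definition matrix_norm :: "real^'n^'n \<Rightarrow> real" where
  "matrix_norm A = onorm ((*v) A)"

definition pos_def :: "real^'n^'n \<Rightarrow> bool" where
  "pos_def A \<longleftrightarrow> (\<forall>v. v \<noteq> 0 \<longrightarrow> v \<bullet> (A *v v) > 0)"

record arc_params =
  theta :: real
  alpha :: real
  sigma_min :: real
  eta1 :: real
  eta2 :: real
  gamma1 :: real
  gamma2 :: real
  gamma3 :: real
  C_init :: real   \<comment> \<open>the constant \<open>C\<close>, as opposed to the accuracies \<open>C\<^sub>k\<close>\<close>

definition valid_params :: "arc_params \<Rightarrow> real \<Rightarrow> bool" where
  "valid_params p \<sigma>0 \<longleftrightarrow>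
     0 < theta p \<and> theta p < 1 \<and>
     0 \<le> alpha p \<and> alpha p < 2 / 3 \<and>
     0 < sigma_min p \<and> sigma_min p \<le> \<sigma>0 \<and>
     0 < eta1 p \<and> eta1 p \<le> eta2 p \<and> eta2 p < (2 - 3 * alpha p) / 2 \<and>
     0 < gamma1 p \<and> gamma1 p < 1 \<and> 1 < gamma2 p \<and> gamma2 p < gamma3 p \<and>
     0 < C_init p"

text \<open>The quantities of iteration \<open>k\<close>: \<open>x\<^sub>k\<close>, \<open>\<sigma>\<^sub>k\<close>, \<open>C\<^sub>k\<close>, flag (\<open>True\<close> for 1),
  \<open>\<D>\<^sub>k\<close>, \<open>B\<^sub>k\<close>, \<open>\<theta>\<^sub>k\<close>, \<open>s\<^sub>k\<close>.\<close>

record ('n::finite) arc_iter =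
  iterate :: "real^'n"
  sigma :: real
  accuracy :: real
  flag :: bool
  sample :: "nat set"
  hess_approx :: "real^'n^'n"
  theta_k :: real
  trial_step :: "real^'n"

definition T2 :: "(real^'n \<Rightarrow> real) \<Rightarrow> real^'n^'n \<Rightarrow> real^'n \<Rightarrow> real^'n \<Rightarrow> real" where
  "T2 f B x s = f x + grad f x \<bullet> s + 1 / 2 * (s \<bullet> (B *v s))"

definition model ::
  "(real^'n \<Rightarrow> real) \<Rightarrow> real^'n^'n \<Rightarrow> real^'n \<Rightarrow> real^'n \<Rightarrow> real \<Rightarrow> real" where
  "model f B x s \<sigma> = T2 f B x s + \<sigma> / 3 * norm s ^ 3"

definition rho :: "(real^'n \<Rightarrow> real) \<Rightarrow> 'n arc_iter \<Rightarrow> real" where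
  "rho f it = (let x = iterate it; s = trial_step it; B = hess_approx it in
     (f x - f (x + s)) / (T2 f B x 0 - T2 f B x s))"

definition sampled_hessian ::
  "(nat \<Rightarrow> real^'n \<Rightarrow> real) \<Rightarrow> nat \<Rightarrow> 'n arc_iter \<Rightarrow> bool" where
  "sampled_hessian \<phi> N it \<longleftrightarrow>
     sample it \<noteq> {} \<and> sample it \<subseteq> {1..N} \<and>
     hess_approx it =
       (1 / real (card (sample it))) *\<^sub>R (\<Sum>i\<in>sample it. hessian (\<phi> i) (iterate it))"

definition trial_step_ok :: "arc_params \<Rightarrow> (real^'n \<Rightarrow> real) \<Rightarrow> 'n arc_iter \<Rightarrow> bool" where
  "trial_step_ok p f it \<longleftrightarrow> (let x = iterate it; s = trial_step it; B = hess_approx it; \<sigma> = sigma it in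
     theta_k it \<le> theta p \<and>
     model f B x s \<sigma> < model f B x 0 \<sigma> \<and>
     norm (grad (\<lambda>s'. model f B x s' \<sigma>) s) \<le> theta_k it * norm (grad f x))"

text \<open>The test under which the step is abandoned, before \<open>\<rho>\<^sub>k\<close> is computed, in order to switch to a
  gradient-dependent accuracy.  Such an iteration is unsuccessful.\<close>

definition discarded :: "arc_params \<Rightarrow> (real^'n \<Rightarrow> real) \<Rightarrow> 'n arc_iter \<Rightarrow> bool" where
  "discarded p f it \<longleftrightarrow>
     norm (trial_step it) < 1 \<and> flag it \<and>
     C_init p > alpha p * (1 - theta p) * norm (grad f (iterate it))"

definition successful :: "arc_params \<Rightarrow> (real^'n \<Rightarrow> real) \<Rightarrow> 'n arc_iter \<Rightarrow> bool" where
  "successful p f it \<longleftrightarrow> \<not> discarded p f it \<and> rho f it \<ge> eta1 p"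

text \<open>After a rejection (\<open>\<rho>\<^sub>k < \<eta>\<^sub>1\<close>) only a new step is computed, so the Hessian approximation and
  the flag are kept; after an abandoned step a new sample may be drawn.\<close>

definition arc_update ::
  "arc_params \<Rightarrow> (real^'n \<Rightarrow> real) \<Rightarrow> 'n arc_iter \<Rightarrow> 'n arc_iter \<Rightarrow> bool" where
  "arc_update p f it it' \<longleftrightarrow>
     (if discarded p f it then
        iterate it' = iterate it \<and> sigma it' = sigma it \<and>
        accuracy it' = alpha p * (1 - theta p) * norm (grad f (iterate it)) \<and> \<not> flag it'
      else if rho f it \<ge> eta1 p then
        iterate it' = iterate it + trial_step it \<and>
        (if rho f it \<ge> eta2 p
         then sigma it' \<in> {max (sigma_min p) (gamma1 p * sigma it) .. sigma it}
         else sigma it' \<in> {sigma it .. gamma2 p * sigma it}) \<and>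
        (if norm (trial_step it) \<ge> 1
         then accuracy it' = C_init p \<and> flag it'
         else accuracy it' = alpha p * (1 - theta p) * norm (grad f (iterate it')) \<and> \<not> flag it')
      else
        iterate it' = iterate it \<and>
        sigma it' \<in> {gamma2 p * sigma it .. gamma3 p * sigma it} \<and>
        accuracy it' = accuracy it \<and> flag it' = flag it \<and>
        hess_approx it' = hess_approx it)"

text \<open>\<open>r\<close> is an execution from \<open>(x\<^sub>0, \<sigma>\<^sub>0)\<close> in which exactly the iterations \<open>k < M\<close> are carried out.
  If \<open>M\<close> is finite, the only meaningful fields of \<open>r M\<close> are those determined by
  the last update.\<close>

definition arc_iterations ::
  "arc_params \<Rightarrow> (nat \<Rightarrow> real^'n \<Rightarrow> real) \<Rightarrow> nat \<Rightarrow> (real^'n \<Rightarrow> real) \<Rightarrow> real^'n \<Rightarrow> real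
     \<Rightarrow> enat \<Rightarrow> (nat \<Rightarrow> 'n arc_iter) \<Rightarrow> bool" where
  "arc_iterations p \<phi> N f x0 \<sigma>0 M r \<longleftrightarrow>
     iterate (r 0) = x0 \<and> sigma (r 0) = \<sigma>0 \<and> accuracy (r 0) = C_init p \<and> flag (r 0) \<and>
     (\<forall>k. enat k < M \<longrightarrow>
        sampled_hessian \<phi> N (r k) \<and> trial_step_ok p f (r k) \<and> arc_update p f (r k) (r (Suc k)))"

text \<open>Stopping at the first iterate whose gradient norm is below \<open>\<epsilon>\<close>; \<open>M = \<infinity>\<close> means that
  the tolerance is never met.\<close>

definition stopped_at :: "(real^'n \<Rightarrow> real) \<Rightarrow> real \<Rightarrow> enat \<Rightarrow> (nat \<Rightarrow> 'n arc_iter) \<Rightarrow> bool" where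
  "stopped_at f \<epsilon> M r \<longleftrightarrow>
     (\<forall>k. enat k < M \<longrightarrow> \<not> norm (grad f (iterate (r k))) < \<epsilon>) \<and>
     (\<forall>m. M = enat m \<longrightarrow> norm (grad f (iterate (r m))) < \<epsilon>)"

text \<open>For a nonzero gradient the minimiser over \<open>a \<ge> 0\<close> is unique; for a zero gradient every
  \<open>a\<close> gives the same Cauchy step 0.\<close>

definition cauchy_coeff :: "(real^'n \<Rightarrow> real) \<Rightarrow> 'n arc_iter \<Rightarrow> real" where
  "cauchy_coeff f it =
     (ARG_MIN (\<lambda>a. model f (hess_approx it) (iterate it) (- a *\<^sub>R grad f (iterate it)) (sigma it))
        a. 0 \<le> a)"

definition cauchy_step :: "(real^'n \<Rightarrow> real) \<Rightarrow> 'n arc_iter \<Rightarrow> real^'n" where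
  "cauchy_step f it = - cauchy_coeff f it *\<^sub>R grad f (iterate it)"

definition cauchy_condition :: "(real^'n \<Rightarrow> real) \<Rightarrow> enat \<Rightarrow> (nat \<Rightarrow> 'n arc_iter) \<Rightarrow> bool" where
  "cauchy_condition f M r \<longleftrightarrow>
     (\<forall>k. enat k < M \<longrightarrow>
        model f (hess_approx (r k)) (iterate (r k)) (trial_step (r k)) (sigma (r k))
        \<le> model f (hess_approx (r k)) (iterate (r k)) (cauchy_step f (r k)) (sigma (r k)))"

end

theory Submission
  imports Defs
begin

text \<open>
  The cubic regularisation makes up for any bounded error of the Hessian approximations.
  The Hessians of all the summands are bounded by \<^term>\<open>\<kappa>_bar\<close>, so with
  \<^term>\<open>L = 1 + \<kappa>_bar\<close> the gradient of \<^term>\<open>f\<close> is \<^term>\<open>L\<close>-Lipschitz and every sampled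
  Hessian has curvature at most \<^term>\<open>L\<close>, whatever the sample is.

  Let \<^term>\<open>G\<close> be the gradient norm, \<^term>\<open>\<sigma>\<close> the weight, and
  \<^term>\<open>w = max L (sqrt (\<sigma> * G))\<close> the effective curvature of the model along the gradient.
  A Cauchy step lowers the model by at least \<^term>\<open>G\<^sup>2 / (6 * w)\<close>, and a step that lowers the
  model has length at most \<^term>\<open>3 * w / \<sigma>\<close>.  If \<^term>\<open>\<sigma> * G\<close> is large, the model
  error, of the order of \<^term>\<open>L\<close> times the squared length, is therefore a small fraction of the
  predicted decrease, and the weight is not increased
  (\<open>very_successful_if_above_threshold\<close>).

  Complexity: as long as \<^term>\<open>\<epsilon> \<le> G\<close>, the weight thus stays of the order of
  \<^term>\<open>1 / \<epsilon>\<close>, and each successful iteration gains a multiple of \<^term>\<open>\<epsilon>\<^sup>2\<close>.  As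
  \<^term>\<open>f\<close> is bounded below, there are at most a multiple of \<^term>\<open>1 / \<epsilon>\<^sup>2\<close> of them
  (\<open>successful_count_bound\<close>); and the tolerance is met, since otherwise eventually all steps
  would be rejected and the weight would be unbounded (\<open>small_gradient_reached\<close>).

  Gradients tend to zero: where the gradient norm is at least \<^term>\<open>\<epsilon>\<close>, the decrease of
  \<^term>\<open>f\<close> eventually dominates a multiple of the distance travelled
  (\<open>decrease_or_short_step\<close>).  Since the values of \<^term>\<open>f\<close> converge, the iterates cannot
  travel far enough between a gradient of norm \<^term>\<open>2 * \<epsilon>\<close> and one of norm \<^term>\<open>\<epsilon>\<close>.

  Convergence: the cubic term alone makes the decrease of \<^term>\<open>f\<close> dominate the cube of the step,
  because the weight is bounded below (\<open>decrease_ge_cube\<close>).  So the steps tend to zero.  An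
  accumulation point with positive definite Hessian is an isolated critical point, and a sequence
  with vanishing steps and vanishing gradients cannot leave its neighbourhood
  (\<open>tendsto_isolated_zero\<close>).
\<close>

section \<open>Gradients, Hessians and isolated zeros\<close>

lemma GDERIV_unique:
  fixes f :: "'a::real_inner \<Rightarrow> real"
  assumes "GDERIV f x :> a" and "GDERIV f x :> b"
  shows "a = b"
proof -
  have "(\<lambda>h. h \<bullet> a) = (\<lambda>h. h \<bullet> b)"
    using assms unfolding gderiv_def by (rule has_derivative_unique)
  then have "(a - b) \<bullet> a = (a - b) \<bullet> b"
    by (rule fun_cong)
  then have "(a - b) \<bullet> (a - b) = 0"
    by (simp add: inner_diff_right)
  then show ?thesis
    by simp
qed

lemma grad_eqI: "GDERIV f x :> g \<Longrightarrow> grad f x = g"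
  unfolding grad_def by (blast intro: GDERIV_unique the_equality)

lemma GDERIV_grad:
  fixes f :: "real^'n \<Rightarrow> real"
  assumes "f differentiable (at x)"
  shows "GDERIV f x :> grad f x"
proof -
  obtain D where D: "(f has_derivative D) (at x)"
    using assms unfolding differentiable_def by blast
  then have lin: "linear D"
    by (rule has_derivative_linear)
  define g where "g = (\<Sum>b\<in>Basis. D b *\<^sub>R b)"
  have "D h = h \<bullet> g" for h
  proof -
    have "D h = D (\<Sum>b\<in>Basis. (h \<bullet> b) *\<^sub>R b)"
      by (simp add: euclidean_representation)
    also have "\<dots> = (\<Sum>b\<in>Basis. (h \<bullet> b) * D b)"
      by (simp add: linear_sum[OF lin] linear_cmul[OF lin])
    also have "\<dots> = h \<bullet> g"
      by (simp add: g_def inner_sum_right mult.commute)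
    finally show ?thesis .
  qed
  then have "D = (\<lambda>h. h \<bullet> g)" ..
  with D have "GDERIV f x :> g"
    by (simp add: gderiv_def)
  then show ?thesis
    using grad_eqI by metis
qed

lemma grad_has_derivative_hessian:
  assumes "twice_differentiable f"
  shows "(grad f has_derivative (*v) (hessian f x)) (at x)"
  using assms jacobian_works[of "grad f" "at x"]
  unfolding twice_differentiable_def hessian_def by simp

lemma norm_matrix_vector_le:
  fixes A :: "real^'n^'n"
  shows "norm (A *v v) \<le> matrix_norm A * norm v"
  unfolding matrix_norm_def by (rule onorm) simp

lemma grad_lipschitz:
  fixes f :: "real^'n \<Rightarrow> real"
  assumes f: "twice_differentiable f" and H: "\<And>x. matrix_norm (hessian f x) \<le> L"
  shows "norm (grad f y - grad f x) \<le> L * norm (y - x)"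
proof (rule differentiable_bound)
  show "(grad f has_derivative (*v) (hessian f z)) (at z within UNIV)" for z
    using grad_has_derivative_hessian[OF f] by simp
  show "onorm ((*v) (hessian f z)) \<le> L" for z
    using H unfolding matrix_norm_def .
qed auto

lemma grad_average:
  fixes \<phi> :: "nat \<Rightarrow> real^'n \<Rightarrow> real"
  assumes "\<And>i. i \<in> I \<Longrightarrow> \<phi> i differentiable (at x)"
  shows "grad (\<lambda>x. c * (\<Sum>i\<in>I. \<phi> i x)) x = c *\<^sub>R (\<Sum>i\<in>I. grad (\<phi> i) x)"
proof (rule grad_eqI)
  have "(\<phi> i has_derivative (\<lambda>h. h \<bullet> grad (\<phi> i) x)) (at x)" if "i \<in> I" for i
    using GDERIV_grad[OF assms[OF that]] unfolding gderiv_def .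
  then have "((\<lambda>x. c * (\<Sum>i\<in>I. \<phi> i x)) has_derivative (\<lambda>h. c * (\<Sum>i\<in>I. h \<bullet> grad (\<phi> i) x))) (at x)"
    by (intro has_derivative_mult_right has_derivative_sum)
  then show "GDERIV (\<lambda>x. c * (\<Sum>i\<in>I. \<phi> i x)) x :> c *\<^sub>R (\<Sum>i\<in>I. grad (\<phi> i) x)"
    by (simp add: gderiv_def inner_sum_right)
qed

lemma linearisation_error:
  fixes f :: "real^'n \<Rightarrow> real"
  assumes diff: "\<And>x. f differentiable (at x)"
    and lip: "\<And>x y. norm (grad f y - grad f x) \<le> L * norm (y - x)" and L: "0 \<le> L"
  shows "\<bar>f (x + s) - f x - grad f x \<bullet> s\<bar> \<le> L * norm s ^ 2"
proof -
  have "norm (f (x + s) - f x - ((x + s) - x) \<bullet> grad f x) \<le> norm ((x + s) - x) * (L * norm s)"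
  proof (rule differentiable_bound_linearization
      [where S = "cball x (norm s)" and f' = "\<lambda>y h. h \<bullet> grad f y" and ?x0.0 = x])
    show "x + t *\<^sub>R (x + s - x) \<in> cball x (norm s)" if "t \<in> {0..1}" for t
      using that by (simp add: dist_norm mult_left_le_one_le)
    show "(f has_derivative (\<lambda>h. h \<bullet> grad f y)) (at y within cball x (norm s))" for y
      using GDERIV_grad[OF diff] unfolding gderiv_def by (rule has_derivative_at_withinI)
    show "onorm ((\<lambda>h. h \<bullet> grad f y) - (\<lambda>h. h \<bullet> grad f x)) \<le> L * norm s"
      if y: "y \<in> cball x (norm s)" for y
    proof (rule onorm_le)
      fix h
      have "norm (((\<lambda>h. h \<bullet> grad f y) - (\<lambda>h. h \<bullet> grad f x)) h) = \<bar>h \<bullet> (grad f y - grad f x)\<bar>"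
        by (simp add: inner_diff_right)
      also have "\<dots> \<le> norm h * norm (grad f y - grad f x)"
        by (rule Cauchy_Schwarz_ineq2)
      also have "\<dots> \<le> norm h * (L * norm s)"
      proof (rule mult_left_mono)
        have "norm (y - x) \<le> norm s"
          using y by (simp add: dist_norm norm_minus_commute)
        then show "norm (grad f y - grad f x) \<le> L * norm s"
          using lip[of y x] L by (meson mult_left_mono order_trans)
      qed simp
      finally show "norm (((\<lambda>h. h \<bullet> grad f y) - (\<lambda>h. h \<bullet> grad f x)) h) \<le> L * norm s * norm h"
        by (simp add: mult.commute)
    qed
    show "x \<in> cball x (norm s)"
      by simp
  qed
  then show ?thesis
    by (simp add: inner_commute power2_eq_square mult.commute mult.left_commute)
qed

text \<open>A positive definite derivative is injective, so it keeps the linear part of the map away from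
  zero by more than the remainder near the point.\<close>

lemma isolated_zero_of_pos_def_derivative:
  fixes F :: "real^'n \<Rightarrow> real^'n"
  assumes deriv: "(F has_derivative (*v) A) (at x)" and A: "pos_def A" and Fx: "F x = 0"
  obtains \<delta> where "0 < \<delta>" and "\<And>y. norm (y - x) \<le> \<delta> \<Longrightarrow> F y = 0 \<Longrightarrow> y = x"
proof -
  have lin: "linear ((*v) A)"
    by simp
  have "inj ((*v) A)"
    unfolding linear_injective_0[OF lin] using A unfolding pos_def_def
    by (metis inner_zero_right less_irrefl)
  then obtain b where b: "0 < b" "\<And>v. b * norm v \<le> norm (A *v v)"
    using linear_inj_bounded_below_pos[OF lin] by blast
  obtain d where d: "0 < d"
    "\<And>y. norm (y - x) < d \<Longrightarrow> norm (F y - F x - A *v (y - x)) \<le> b / 2 * norm (y - x)"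
    using deriv b(1) unfolding has_derivative_at_alt by (metis half_gt_zero)
  show thesis
  proof
    show "0 < d / 2"
      using d(1) by simp
    fix y assume y: "norm (y - x) \<le> d / 2" and Fy: "F y = 0"
    have "b * norm (y - x) \<le> norm (A *v (y - x))"
      by (rule b(2))
    also have "\<dots> = norm (F y - F x - A *v (y - x))"
      by (simp add: Fx Fy)
    also have "\<dots> \<le> b / 2 * norm (y - x)"
      using d y by (intro d(2)) simp
    finally show "y = x"
      using b(1) by simp
  qed
qed

text \<open>Around an isolated zero there is an annulus on which the map is bounded away from zero.  The
  sequence eventually avoids it, and its steps are eventually too short to jump across.\<close>

lemma tendsto_isolated_zero:
  fixes F :: "'a::heine_borel \<Rightarrow> 'b::real_normed_vector"
  assumes cont: "continuous_on UNIV F"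
    and isolated: "0 < \<delta>" "\<And>y. dist y x \<le> \<delta> \<Longrightarrow> F y = 0 \<Longrightarrow> y = x"
    and zero: "(\<lambda>k. norm (F (X k))) \<longlonglongrightarrow> 0"
    and steps: "(\<lambda>k. dist (X (Suc k)) (X k)) \<longlonglongrightarrow> 0"
    and j: "strict_mono j" and lim: "(\<lambda>i. X (j i)) \<longlonglongrightarrow> x"
  shows "X \<longlonglongrightarrow> x"
proof (rule metric_LIMSEQ_I)
  fix e :: real
  assume e: "0 < e"
  define d where "d = min e \<delta>"
  have d: "0 < d" "d \<le> e" "d \<le> \<delta>"
    using e isolated(1) by (auto simp: d_def)
  define A where "A = cball x d - ball x (d / 2)"
  have "compact A"
    by (simp add: A_def compact_diff)
  obtain c where c: "0 < c" "\<And>y. y \<in> A \<Longrightarrow> c \<le> norm (F y)"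
  proof (cases "A = {}")
    case True
    then show thesis
      using that[of 1] by simp
  next
    case False
    have "continuous_on A (\<lambda>y. norm (F y))"
      using cont by (intro continuous_on_norm) (rule continuous_on_subset, auto)
    then obtain y where y: "y \<in> A" "\<And>z. z \<in> A \<Longrightarrow> norm (F y) \<le> norm (F z)"
      using continuous_attains_inf[OF \<open>compact A\<close> False] by blast
    have "F y \<noteq> 0"
      using y(1) isolated(2)[of y] d by (auto simp: A_def dist_commute)
    then show thesis
      using that[of "norm (F y)"] y(2) by simp
  qed
  have "\<forall>\<^sub>F k in sequentially. norm (F (X k)) < c \<and> dist (X (Suc k)) (X k) < d / 2"
    using order_tendstoD(2)[OF zero c(1)] order_tendstoD(2)[OF steps, of "d / 2"] d(1)
    by (intro eventually_conj) auto
  then obtain m where m: "\<And>k. m \<le> k \<Longrightarrow> norm (F (X k)) < c"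
    "\<And>k. m \<le> k \<Longrightarrow> dist (X (Suc k)) (X k) < d / 2"
    unfolding eventually_sequentially by blast
  obtain i0 where i0: "\<And>i. i0 \<le> i \<Longrightarrow> dist (X (j i)) x < d / 2"
    using metric_LIMSEQ_D[OF lim, of "d / 2"] d(1) by auto
  define n where "n = j (max i0 m)"
  have n: "m \<le> n" "dist (X n) x < d / 2"
    using i0[of "max i0 m"] strict_mono_imp_increasing[OF j, of "max i0 m"]
    by (auto simp: n_def)
  have "dist (X k) x < d / 2" if "n \<le> k" for k
    using that
  proof (induction k rule: dec_induct)
    case base
    show ?case
      by (rule n(2))
  next
    case (step k)
    have "dist (X (Suc k)) x < d"
      using dist_triangle[of "X (Suc k)" x "X k"] m(2)[of k] step n(1) by simp
    moreover have "X (Suc k) \<notin> A"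
      using c(2)[of "X (Suc k)"] m(1)[of "Suc k"] step n(1) by force
    ultimately show ?case
      by (auto simp: A_def dist_commute)
  qed
  then have "dist (X k) x < e" if "n \<le> k" for k
    using that d by force
  then show "\<exists>n. \<forall>k\<ge>n. dist (X k) x < e"
    by blast
qed

section \<open>The cubic model\<close>

definition curvature_bounded :: "real \<Rightarrow> real^'n^'n \<Rightarrow> bool" where
  "curvature_bounded L B \<longleftrightarrow> (\<forall>v. \<bar>v \<bullet> (B *v v)\<bar> \<le> L * norm v ^ 2)"

text \<open>Along the steepest descent direction the cubic term acts like a curvature of size
  \<^term>\<open>sqrt (\<sigma> * norm g)\<close>, since
  \<^term>\<open>- a * norm g ^ 2 + \<sigma> / 3 * (a * norm g) ^ 3\<close> is least, over \<^term>\<open>a \<ge> 0\<close>, at the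
  inverse of that number.  The following is the larger of that curvature and the one that bounds the quadratic term.\<close>

definition effective_curvature :: "real \<Rightarrow> real \<Rightarrow> real \<Rightarrow> real" where
  "effective_curvature L \<sigma> G = max L (sqrt (\<sigma> * G))"

lemma effective_curvature:
  assumes "1 \<le> L"
  shows "L \<le> effective_curvature L \<sigma> G" and "0 < effective_curvature L \<sigma> G"
    and "\<sigma> * G \<le> (effective_curvature L \<sigma> G)\<^sup>2"
proof -
  show "L \<le> effective_curvature L \<sigma> G" "0 < effective_curvature L \<sigma> G"
    using assms by (auto simp: effective_curvature_def)
  have "sqrt (\<sigma> * G) \<le> effective_curvature L \<sigma> G"
    by (simp add: effective_curvature_def)
  then show "\<sigma> * G \<le> (effective_curvature L \<sigma> G)\<^sup>2"
    by (rule sqrt_le_D)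
qed

lemma average_curvature_bounded:
  fixes A :: "'i \<Rightarrow> real^'n^'n"
  assumes I: "finite I" "I \<noteq> {}" and A: "\<And>i. i \<in> I \<Longrightarrow> matrix_norm (A i) \<le> L"
  shows "curvature_bounded L ((1 / real (card I)) *\<^sub>R (\<Sum>i\<in>I. A i))"
  unfolding curvature_bounded_def
proof
  fix v :: "real^'n"
  have each: "\<bar>v \<bullet> (A i *v v)\<bar> \<le> L * norm v ^ 2" if "i \<in> I" for i
  proof -
    have "\<bar>v \<bullet> (A i *v v)\<bar> \<le> norm v * norm (A i *v v)"
      by (rule Cauchy_Schwarz_ineq2)
    also have "\<dots> \<le> norm v * (L * norm v)"
      using norm_matrix_vector_le[of "A i" v] A[OF that]
      by (meson mult_left_mono mult_right_mono norm_ge_zero order_trans)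
    finally show ?thesis
      by (simp add: power2_eq_square mult.commute mult.left_commute)
  qed
  have mv: "(\<Sum>i\<in>I. A i) *v v = (\<Sum>i\<in>I. A i *v v)"
    using I(1) by (induction I rule: finite_induct) (auto simp: matrix_vector_mult_add_rdistrib)
  have "\<bar>\<Sum>i\<in>I. v \<bullet> (A i *v v)\<bar> \<le> (\<Sum>i\<in>I. \<bar>v \<bullet> (A i *v v)\<bar>)"
    by (rule sum_abs)
  also have "\<dots> \<le> real (card I) * (L * norm v ^ 2)"
    using each by (rule sum_bounded_above)
  finally have "\<bar>\<Sum>i\<in>I. v \<bullet> (A i *v v)\<bar> / real (card I) \<le> L * norm v ^ 2"
    using I by (simp add: divide_le_eq card_gt_0_iff mult.commute)
  then show "\<bar>v \<bullet> (((1 / real (card I)) *\<^sub>R (\<Sum>i\<in>I. A i)) *v v)\<bar> \<le> L * norm v ^ 2"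
    by (simp add: scaleR_matrix_vector_assoc[symmetric] mv inner_sum_right abs_divide)
qed

lemma model_zero [simp]: "model f B x 0 \<sigma> = f x"
  by (simp add: model_def T2_def)

text \<open>Outside the ball below, the cubic term dominates the linear and the quadratic one.\<close>

lemma step_bound:
  assumes B: "curvature_bounded L B" and L: "1 \<le> L" and \<sigma>: "0 < \<sigma>"
    and le: "model f B x s \<sigma> \<le> f x"
  shows "\<sigma> * norm s \<le> 3 * effective_curvature L \<sigma> (norm (grad f x))"
proof (rule ccontr)
  define w where "w = effective_curvature L \<sigma> (norm (grad f x))"
  define n where "n = norm s"
  define G where "G = norm (grad f x)"
  assume "\<not> ?thesis"
  then have big: "3 * w < \<sigma> * n"
    by (simp add: w_def n_def)
  have w: "L \<le> w" "0 < w" "\<sigma> * G \<le> w\<^sup>2"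
    unfolding w_def G_def by (rule effective_curvature[OF L])+
  have "0 < \<sigma> * n"
    using big w by linarith
  then have n: "0 < n"
    using \<sigma> by (simp add: zero_less_mult_iff)
  have "- (G * n) \<le> grad f x \<bullet> s"
    using Cauchy_Schwarz_ineq2[of "grad f x" s] by (simp add: G_def n_def)
  moreover have "- (L * n\<^sup>2) \<le> s \<bullet> (B *v s)"
    using B unfolding curvature_bounded_def n_def by (meson abs_le_D2 minus_le_iff)
  ultimately have "\<sigma> / 3 * n ^ 3 \<le> G * n + L / 2 * n\<^sup>2"
    using le unfolding model_def T2_def n_def by simp
  then have "n * (\<sigma> / 3 * n\<^sup>2) \<le> n * (G + L / 2 * n)"
    by (simp add: power2_eq_square power3_eq_cube algebra_simps)
  then have "\<sigma> / 3 * n\<^sup>2 \<le> G + L / 2 * n"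
    using n by simp
  then have "\<sigma> * (\<sigma> / 3 * n\<^sup>2) \<le> \<sigma> * (G + L / 2 * n)"
    using \<sigma> by (intro mult_left_mono) auto
  then have "(\<sigma> * n)\<^sup>2 / 3 \<le> \<sigma> * G + L * (\<sigma> * n) / 2"
    by (simp add: power2_eq_square algebra_simps)
  also have "\<dots> \<le> w\<^sup>2 + w * (\<sigma> * n) / 2"
    using w \<open>0 < \<sigma> * n\<close> by (intro add_mono divide_right_mono mult_right_mono) auto
  also have "\<dots> < (\<sigma> * n) * w"
    using mult_strict_left_mono[of "w + \<sigma> * n / 2" "\<sigma> * n" w] big w(2)
    by (simp add: power2_eq_square distrib_left mult.commute)
  also have "\<dots> \<le> (\<sigma> * n)\<^sup>2 / 3"
    using mult_left_mono[OF less_imp_le[OF big] less_imp_le[OF \<open>0 < \<sigma> * n\<close>]]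
    by (simp add: power2_eq_square)
  finally show False
    by simp
qed

text \<open>A steepest descent step of length \<^term>\<open>norm g / w\<close>, where \<^term>\<open>w\<close> is the effective
  curvature: the linear term gains \<^term>\<open>norm g ^ 2 / w\<close>, of which the quadratic and the
  cubic term take back at most one half and one third.\<close>

lemma steepest_descent_decrease:
  fixes f :: "real^'n \<Rightarrow> real" and x :: "real^'n"
  assumes B: "curvature_bounded L B" and L: "1 \<le> L" and \<sigma>: "0 < \<sigma>"
  defines "w \<equiv> effective_curvature L \<sigma> (norm (grad f x))"
  shows "model f B x (- (1 / w) *\<^sub>R grad f x) \<sigma> \<le> f x - norm (grad f x) ^ 2 / (6 * w)"
proof -
  define g where "g = grad f x"
  define G where "G = norm g"
  have w: "L \<le> w" "0 < w" "\<sigma> * G \<le> w\<^sup>2"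
    unfolding w_def G_def g_def by (rule effective_curvature[OF L])+
  have "g \<bullet> (B *v g) \<le> w * G\<^sup>2"
    using B w(1) unfolding curvature_bounded_def G_def
    by (meson abs_le_D1 mult_right_mono order_trans zero_le_power2)
  then have quad: "1 / 2 * ((1 / w)\<^sup>2 * (g \<bullet> (B *v g))) \<le> 1 / 2 * ((1 / w)\<^sup>2 * (w * G\<^sup>2))"
    by (intro mult_left_mono) auto
  have "(\<sigma> * G) * (G\<^sup>2 / (3 * w ^ 3)) \<le> w\<^sup>2 * (G\<^sup>2 / (3 * w ^ 3))"
    using w by (intro mult_right_mono) auto
  then have cubic: "\<sigma> / 3 * (G / w) ^ 3 \<le> G\<^sup>2 / (3 * w)"
    using w(2) by (simp add: power2_eq_square power3_eq_cube field_simps)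
  have "model f B x (- (1 / w) *\<^sub>R g) \<sigma>
      = f x - G\<^sup>2 / w + 1 / 2 * ((1 / w)\<^sup>2 * (g \<bullet> (B *v g))) + \<sigma> / 3 * (G / w) ^ 3"
    using w(2) unfolding model_def T2_def
    by (simp add: g_def[symmetric] G_def dot_square_norm matrix_vector_mult_scaleR
        vec.neg power2_eq_square)
  also have "\<dots> \<le> f x - G\<^sup>2 / w + 1 / 2 * ((1 / w)\<^sup>2 * (w * G\<^sup>2)) + G\<^sup>2 / (3 * w)"
    using quad cubic by linarith
  also have "\<dots> = f x - G\<^sup>2 / (6 * w)"
    using w(2) by (simp add: field_simps power2_eq_square)
  finally show ?thesis
    by (simp add: g_def G_def)
qed

text \<open>The line search along the negative gradient attains its minimum: by
  the bound on the length of a decreasing step only a compact interval of step sizes matters.\<close>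

lemma cauchy_step_minimises:
  fixes it :: "'n::finite arc_iter"
  assumes B: "curvature_bounded L (hess_approx it)" and L: "1 \<le> L" and \<sigma>: "0 < sigma it"
    and a: "0 \<le> a"
  shows "model f (hess_approx it) (iterate it) (cauchy_step f it) (sigma it)
    \<le> model f (hess_approx it) (iterate it) (- a *\<^sub>R grad f (iterate it)) (sigma it)"
proof (cases "grad f (iterate it) = 0")
  case True
  then show ?thesis
    by (simp add: cauchy_step_def)
next
  case False
  define g where "g = grad f (iterate it)"
  define h where "h b = model f (hess_approx it) (iterate it) (- b *\<^sub>R g) (sigma it)" for b
  define w where "w = effective_curvature L (sigma it) (norm g)"
  define A where "A = 3 * w / (sigma it * norm g)"
  have g: "0 < norm g"
    using False by (simp add: g_def)
  have "0 < w"
    unfolding w_def by (rule effective_curvature(2)[OF L])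
  then have A: "0 \<le> A"
    using \<sigma> g by (simp add: A_def)
  have "continuous_on {0..A} (\<lambda>b. hess_approx it *v (- b *\<^sub>R g))"
    by (rule linear_continuous_on_compose) (auto intro!: continuous_intros)
  then have "continuous_on {0..A} h"
    unfolding h_def model_def T2_def by (intro continuous_intros)
  then obtain b where b: "b \<in> {0..A}" "\<And>c. c \<in> {0..A} \<Longrightarrow> h b \<le> h c"
    using continuous_attains_inf[of "{0..A}" h] A by auto
  have min: "h b \<le> h c" if "0 \<le> c" for c
  proof (cases "c \<le> A")
    case True
    with b(2) that show ?thesis
      by simp
  next
    case False
    then have "3 * w < c * (sigma it * norm g)"
      using \<sigma> g by (simp add: A_def divide_less_eq not_le)
    then have "3 * w < sigma it * norm (- c *\<^sub>R g)"
      using that by (simp add: mult.left_commute)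
    then have "\<not> h c \<le> f (iterate it)"
      using step_bound[OF B L \<sigma>] unfolding h_def g_def w_def by (meson not_le)
    then have "h 0 < h c"
      by (simp add: h_def)
    then show ?thesis
      using b(2)[of 0] A by simp
  qed
  have "h (arg_min h (\<lambda>a. 0 \<le> a)) = h b"
    using b(1) min by (intro arg_min_equality) auto
  moreover have "cauchy_coeff f it = arg_min h (\<lambda>a. 0 \<le> a)"
    unfolding cauchy_coeff_def h_def g_def ..
  ultimately have "h (cauchy_coeff f it) \<le> h a"
    using min[OF a] by simp
  then show ?thesis
    unfolding h_def g_def cauchy_step_def .
qed

section \<open>One iteration\<close>

locale arc_analysis =
  fixes p :: arc_params and \<sigma>0 :: real and f :: "real^'n \<Rightarrow> real" and L f_low :: real
  assumes params: "valid_params p \<sigma>0"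
    and L: "1 \<le> L"
    and differentiable: "\<And>x. f differentiable (at x)"
    and lipschitz: "\<And>x y. norm (grad f y - grad f x) \<le> L * norm (y - x)"
    and lower: "\<And>x. f_low \<le> f x"
begin

text \<open>What the analysis sees of the algorithm's choices: the Hessian approximation enters only
  through the bound on its curvature, which holds for every sample.\<close>

definition admissible :: "'n arc_iter \<Rightarrow> bool" where
  "admissible it \<longleftrightarrow>
     curvature_bounded L (hess_approx it) \<and> sigma_min p \<le> sigma it \<and> trial_step_ok p f it \<and>
     model f (hess_approx it) (iterate it) (trial_step it) (sigma it)
     \<le> model f (hess_approx it) (iterate it) (cauchy_step f it) (sigma it)"

definition predicted :: "'n arc_iter \<Rightarrow> real" where
  "predicted it = T2 f (hess_approx it) (iterate it) 0
     - T2 f (hess_approx it) (iterate it) (trial_step it)"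

abbreviation gnorm :: "'n arc_iter \<Rightarrow> real" where
  "gnorm it \<equiv> norm (grad f (iterate it))"

abbreviation curv :: "'n arc_iter \<Rightarrow> real" where
  "curv it \<equiv> effective_curvature L (sigma it) (gnorm it)"

lemma param_facts:
  "0 < sigma_min p" "0 < eta1 p" "eta1 p \<le> eta2 p" "eta2 p < 1"
  "1 < gamma2 p" "gamma2 p < gamma3 p"
  using params unfolding valid_params_def by auto

lemma admissible_sigma_pos: "admissible it \<Longrightarrow> 0 < sigma it"
  using param_facts unfolding admissible_def by linarith

lemma predicted_eq:
  "predicted it = f (iterate it)
     - model f (hess_approx it) (iterate it) (trial_step it) (sigma it)
     + sigma it / 3 * norm (trial_step it) ^ 3"
  by (simp add: predicted_def model_def T2_def)

lemma rho_eq: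
  "rho f it = (f (iterate it) - f (iterate it + trial_step it)) / predicted it"
  by (simp add: rho_def predicted_def Let_def)

lemma predicted_gt_cube:
  assumes "admissible it"
  shows "sigma it / 3 * norm (trial_step it) ^ 3 < predicted it"
  using assms unfolding admissible_def trial_step_ok_def Let_def predicted_eq by simp

lemma predicted_pos:
  assumes "admissible it"
  shows "0 < predicted it"
proof -
  have "0 \<le> sigma it / 3 * norm (trial_step it) ^ 3"
    using admissible_sigma_pos[OF assms] by simp
  then show ?thesis
    using predicted_gt_cube[OF assms] by linarith
qed

lemma predicted_ge_gradient:
  assumes "admissible it"
  shows "gnorm it ^ 2 / (6 * curv it) \<le> predicted it"
proof -
  have B: "curvature_bounded L (hess_approx it)" and \<sigma>: "0 < sigma it"
    using assms admissible_sigma_pos unfolding admissible_def by auto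
  have "model f (hess_approx it) (iterate it) (trial_step it) (sigma it)
      \<le> model f (hess_approx it) (iterate it) (cauchy_step f it) (sigma it)"
    using assms unfolding admissible_def by blast
  also have "\<dots> \<le> model f (hess_approx it) (iterate it)
      (- (1 / curv it) *\<^sub>R grad f (iterate it)) (sigma it)"
    using effective_curvature(2)[OF L]
    by (intro cauchy_step_minimises[OF B L \<sigma>]) (simp add: less_imp_le)
  also have "\<dots> \<le> f (iterate it) - gnorm it ^ 2 / (6 * curv it)"
    by (rule steepest_descent_decrease[OF B L \<sigma>])
  finally have "gnorm it ^ 2 / (6 * curv it)
      \<le> f (iterate it) - model f (hess_approx it) (iterate it) (trial_step it) (sigma it)"
    by simp
  moreover have "0 \<le> sigma it / 3 * norm (trial_step it) ^ 3"
    using \<sigma> by simp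
  ultimately show ?thesis
    unfolding predicted_eq by linarith
qed

lemma trial_step_bound:
  assumes "admissible it"
  shows "sigma it * norm (trial_step it) \<le> 3 * curv it"
proof (rule step_bound)
  show "curvature_bounded L (hess_approx it)"
    using assms unfolding admissible_def by blast
  show "model f (hess_approx it) (iterate it) (trial_step it) (sigma it) \<le> f (iterate it)"
    using assms unfolding admissible_def trial_step_ok_def Let_def by simp
qed (use L admissible_sigma_pos[OF assms] in auto)

text \<open>Beyond this value of \<^term>\<open>sigma it * gnorm it\<close> the cubic term makes the step so short that
  the model error is a small fraction of the predicted decrease.\<close>

definition success_threshold :: real where
  "success_threshold = (108 * L / (1 - eta2 p))\<^sup>2"

text \<open>Let \<^term>\<open>w\<close> be the effective curvature, which above the threshold is
  \<^term>\<open>sqrt (sigma it * gnorm it)\<close>. The model error is at most \<^term>\<open>2 * L * norm s ^ 2\<close>, where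
  \<^term>\<open>\<sigma> * norm s \<le> 3 * w\<close>, so after scaling by \<^term>\<open>\<sigma> ^ 2\<close> it is at most
  \<^term>\<open>18 * L * w ^ 2\<close>. The predicted decrease is, on the same scale, at least
  \<^term>\<open>w ^ 3 / 6\<close>, a higher power of \<^term>\<open>w\<close>.  The factor 108 makes the former at most the
  fraction \<^term>\<open>1 - eta2 p\<close> of the latter.\<close>

lemma very_successful_if_above_threshold:
  assumes adm: "admissible it" and large: "success_threshold \<le> sigma it * gnorm it"
  shows "eta2 p \<le> rho f it"
proof -
  define \<sigma> where "\<sigma> = sigma it"
  define G where "G = gnorm it"
  define w where "w = curv it"
  define s where "s = trial_step it"
  define c where "c = 1 - eta2 p"
  define P where "P = predicted it"
  define E where "E = f (iterate it + s) - T2 f (hess_approx it) (iterate it) s"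
  have \<sigma>: "0 < \<sigma>"
    using admissible_sigma_pos[OF adm] by (simp add: \<sigma>_def)
  have c: "0 < c" "c < 1"
    using param_facts by (auto simp: c_def)
  have "108 * L / c \<le> sqrt (\<sigma> * G)"
    using large by (intro real_le_rsqrt) (simp add: success_threshold_def c_def \<sigma>_def G_def)
  moreover have "L \<le> 108 * L / c"
  proof -
    have "L * c \<le> L * 108"
      using c L by (intro mult_left_mono) auto
    then show ?thesis
      using c by (simp add: le_divide_eq mult.commute)
  qed
  ultimately have w_eq: "w = sqrt (\<sigma> * G)" and w_ge: "108 * L / c \<le> w"
    by (auto simp: w_def effective_curvature_def \<sigma>_def[symmetric] G_def[symmetric])
  have w: "0 < w"
    unfolding w_def by (rule effective_curvature(2)[OF L])
  have w2: "w\<^sup>2 = \<sigma> * G"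
    using \<sigma> by (simp add: w_eq G_def)
  have wc: "108 * L \<le> c * w"
    using w_ge c by (simp add: divide_le_eq mult.commute)
  have "E \<le> 2 * L * norm s ^ 2"
  proof -
    have "f (iterate it + s) - f (iterate it) - grad f (iterate it) \<bullet> s \<le> L * norm s ^ 2"
      using linearisation_error[OF differentiable lipschitz, of "iterate it" s] L by simp
    moreover have "- (L * norm s ^ 2) \<le> s \<bullet> (hess_approx it *v s)"
      using adm unfolding admissible_def curvature_bounded_def by (meson abs_le_D2 minus_le_iff)
    ultimately have "E \<le> 3 / 2 * (L * norm s ^ 2)"
      by (simp add: E_def T2_def)
    also have "\<dots> \<le> 2 * L * norm s ^ 2"
      using L by simp
    finally show ?thesis .
  qed
  then have "\<sigma>\<^sup>2 * E \<le> \<sigma>\<^sup>2 * (2 * L * norm s ^ 2)"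
    by (rule mult_left_mono) simp
  also have "\<dots> = 2 * L * (\<sigma> * norm s)\<^sup>2"
    by (simp add: power_mult_distrib)
  also have "\<dots> \<le> 2 * L * (3 * w)\<^sup>2"
    using trial_step_bound[OF adm] \<sigma> L
    by (intro mult_left_mono power_mono) (auto simp: \<sigma>_def w_def s_def)
  also have "\<dots> = 108 * L * w\<^sup>2 / 6"
    by (simp add: power_mult_distrib)
  also have "\<dots> \<le> c * w * w\<^sup>2 / 6"
    using wc by (intro divide_right_mono mult_right_mono) auto
  also have "\<dots> = c * (w\<^sup>2)\<^sup>2 / (6 * w)"
    using w by (simp add: power2_eq_square)
  also have "\<dots> = \<sigma>\<^sup>2 * (c * (G\<^sup>2 / (6 * w)))"
    by (simp add: w2 power_mult_distrib)
  also have "\<dots> \<le> \<sigma>\<^sup>2 * (c * P)"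
    using predicted_ge_gradient[OF adm] c
    by (intro mult_left_mono) (auto simp: G_def w_def P_def)
  finally have "E \<le> c * P"
    using \<sigma> by simp
  moreover have "f (iterate it) - f (iterate it + s) = P - E"
    by (simp add: E_def P_def predicted_def s_def T2_def)
  moreover have "eta2 p * P = P - c * P"
    by (simp add: c_def algebra_simps)
  ultimately have "eta2 p * P \<le> f (iterate it) - f (iterate it + s)"
    by linarith
  then show ?thesis
    using predicted_pos[OF adm] by (simp add: rho_eq le_divide_eq P_def s_def)
qed

lemma iterate_update:
  assumes "arc_update p f it it'"
  shows "iterate it' = (if successful p f it then iterate it + trial_step it else iterate it)"
  using assms unfolding arc_update_def successful_def by (auto split: if_splits)

lemma predicted_fraction_achieved:
  assumes "admissible it" "arc_update p f it it'" "successful p f it"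
  shows "eta1 p * predicted it \<le> f (iterate it) - f (iterate it')"
  using assms predicted_pos[OF assms(1)]
  by (simp add: iterate_update successful_def rho_eq le_divide_eq)

lemma decrease_if_successful:
  assumes "admissible it" "arc_update p f it it'" "successful p f it"
  shows "eta1 p * (gnorm it ^ 2 / (6 * curv it)) \<le> f (iterate it) - f (iterate it')"
  using predicted_fraction_achieved[OF assms]
    mult_left_mono[OF predicted_ge_gradient[OF assms(1)], of "eta1 p"] param_facts by linarith

text \<open>The cubic term is a part of the predicted decrease, and its weight is bounded below.  This
  makes the steps tend to zero although the quadratic model may be far from the function.\<close>

lemma decrease_ge_cube:
  assumes adm: "admissible it" and upd: "arc_update p f it it'"
  shows "eta1 p * sigma_min p / 3 * norm (iterate it' - iterate it) ^ 3
    \<le> f (iterate it) - f (iterate it')"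
proof (cases "successful p f it")
  case True
  have "sigma_min p / 3 * norm (trial_step it) ^ 3 \<le> sigma it / 3 * norm (trial_step it) ^ 3"
    using adm unfolding admissible_def by (intro mult_right_mono) auto
  also have "\<dots> \<le> predicted it"
    using predicted_gt_cube[OF adm] by simp
  finally have "eta1 p * (sigma_min p / 3 * norm (trial_step it) ^ 3) \<le> eta1 p * predicted it"
    using param_facts by (intro mult_left_mono) auto
  also have "\<dots> \<le> f (iterate it) - f (iterate it')"
    by (rule predicted_fraction_achieved[OF adm upd True])
  finally show ?thesis
    using True by (simp add: iterate_update[OF upd])
next
  case False
  then show ?thesis
    by (simp add: iterate_update[OF upd])
qed

lemma iterate_monotone:
  assumes "admissible it" "arc_update p f it it'"
  shows "f (iterate it') \<le> f (iterate it)"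
proof -
  have "0 \<le> eta1 p * sigma_min p / 3 * norm (iterate it' - iterate it) ^ 3"
    using param_facts by simp
  then show ?thesis
    using decrease_ge_cube[OF assms] by linarith
qed

text \<open>Either the curvature \<^term>\<open>L\<close> is the effective one, and the decrease is at least a constant;
  or it is \<^term>\<open>w = sqrt (\<sigma> * G)\<close>, and then the bound \<^term>\<open>3 * w / \<sigma>\<close> on the length of the step is
  \<^term>\<open>3 * G / w\<close>, so that the decrease, of order \<^term>\<open>G ^ 2 / w\<close>, is at least of the order of
  \<^term>\<open>G\<close> times this length.\<close>

lemma decrease_or_short_step:
  assumes adm: "admissible it" and upd: "arc_update p f it it'"
    and \<epsilon>: "0 < \<epsilon>" "\<epsilon> \<le> gnorm it"
  shows "eta1 p * \<epsilon>\<^sup>2 / (6 * L) \<le> f (iterate it) - f (iterate it') \<or>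
    eta1 p * \<epsilon> / 18 * norm (iterate it' - iterate it) \<le> f (iterate it) - f (iterate it')"
proof (cases "successful p f it")
  case False
  then show ?thesis
    by (simp add: iterate_update[OF upd])
next
  case True
  define G where "G = gnorm it"
  define w where "w = curv it"
  define \<sigma> where "\<sigma> = sigma it"
  define s where "s = trial_step it"
  have dec: "eta1 p * (G\<^sup>2 / (6 * w)) \<le> f (iterate it) - f (iterate it')"
    using decrease_if_successful[OF adm upd True] by (simp add: G_def w_def)
  have w: "0 < w"
    unfolding w_def by (rule effective_curvature(2)[OF L])
  have G: "0 < G" "\<epsilon> \<le> G"
    using \<epsilon> by (auto simp: G_def)
  have \<sigma>: "0 < \<sigma>"
    using admissible_sigma_pos[OF adm] by (simp add: \<sigma>_def)
  consider "w = L" | "w = sqrt (\<sigma> * G)"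
    unfolding w_def effective_curvature_def \<sigma>_def G_def by linarith
  then show ?thesis
  proof cases
    case 1
    have "eta1 p * \<epsilon>\<^sup>2 / (6 * L) \<le> eta1 p * G\<^sup>2 / (6 * L)"
      using L \<epsilon> G param_facts by (intro divide_right_mono mult_left_mono power_mono) auto
    with dec 1 show ?thesis
      by simp
  next
    case 2
    then have w2: "w\<^sup>2 = \<sigma> * G"
      using \<sigma> G by simp
    have "\<sigma> * norm s \<le> 3 * w"
      using trial_step_bound[OF adm] by (simp add: \<sigma>_def s_def w_def)
    then have "(\<sigma> * norm s) * (G * w) \<le> (3 * w) * (G * w)"
      using G w by (intro mult_right_mono) auto
    moreover have "(\<sigma> * norm s) * (G * w) = w\<^sup>2 * (w * norm s)"
      by (simp add: w2)
    moreover have "(3 * w) * (G * w) = w\<^sup>2 * (3 * G)"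
      by (simp add: power2_eq_square)
    ultimately have "w\<^sup>2 * (w * norm s) \<le> w\<^sup>2 * (3 * G)"
      by simp
    then have "w * norm s \<le> 3 * G"
      using w by simp
    then have len: "norm s \<le> 3 * G / w"
      using w by (simp add: le_divide_eq mult.commute)
    have "eta1 p * \<epsilon> / 18 * norm s \<le> eta1 p * G / 18 * (3 * G / w)"
      using len G \<epsilon> param_facts by (intro mult_mono divide_right_mono mult_left_mono) auto
    also have "\<dots> = eta1 p * (G\<^sup>2 / (6 * w))"
      by (simp add: power2_eq_square)
    finally show ?thesis
      using dec True by (simp add: iterate_update[OF upd] s_def)
  qed
qed

text \<open>The weight grows only below the threshold, and by at most the factor \<^term>\<open>gamma3 p\<close>.  So
  until a gradient of norm below \<^term>\<open>\<epsilon>\<close> is met, it stays of the order of \<^term>\<open>1 / \<epsilon>\<close>.\<close>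

lemma sigma_bound_step:
  assumes adm: "admissible it" and upd: "arc_update p f it it'"
    and \<epsilon>: "0 < \<epsilon>" "\<epsilon> \<le> gnorm it"
    and S: "\<epsilon> * sigma it \<le> S" "gamma3 p * success_threshold \<le> S"
  shows "\<epsilon> * sigma it' \<le> S"
proof (cases "sigma it' \<le> sigma it")
  case True
  then have "\<epsilon> * sigma it' \<le> \<epsilon> * sigma it"
    using \<epsilon> by simp
  with S show ?thesis
    by linarith
next
  case False
  have \<sigma>: "0 < sigma it"
    by (rule admissible_sigma_pos[OF adm])
  have "\<not> eta2 p \<le> rho f it"
    using False upd param_facts unfolding arc_update_def by (auto split: if_splits)
  then have less: "sigma it * gnorm it < success_threshold"
    using very_successful_if_above_threshold[OF adm] by linarith
  have "gamma2 p * sigma it \<le> gamma3 p * sigma it"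
    using param_facts \<sigma> by simp
  then have "sigma it' \<le> gamma3 p * sigma it"
    using False upd unfolding arc_update_def by (auto split: if_splits)
  then have "\<epsilon> * sigma it' \<le> \<epsilon> * (gamma3 p * sigma it)"
    using \<epsilon> by simp
  also have "\<dots> \<le> gnorm it * (gamma3 p * sigma it)"
    using \<epsilon> \<sigma> param_facts by (intro mult_right_mono) auto
  also have "\<dots> = gamma3 p * (sigma it * gnorm it)"
    by (simp add: mult.commute mult.left_commute)
  also have "\<dots> \<le> gamma3 p * success_threshold"
    using less param_facts by (intro mult_left_mono) auto
  finally show ?thesis
    using S by linarith
qed

text \<open>Under the bound of order \<^term>\<open>1 / \<epsilon>\<close> on the weight, the effective curvature exceeds a
  constant by at most the factor \<^term>\<open>gnorm it / \<epsilon>\<close>, so that \<^term>\<open>gnorm it ^ 2\<close> over the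
  effective curvature is at least of the order of \<^term>\<open>\<epsilon> ^ 2\<close>.\<close>

lemma decrease_at_large_gradient:
  assumes adm: "admissible it" and upd: "arc_update p f it it'" and succ: "successful p f it"
    and \<epsilon>: "0 < \<epsilon>" "\<epsilon> \<le> gnorm it" and S: "\<epsilon> * sigma it \<le> S"
  shows "eta1 p * \<epsilon>\<^sup>2 / (6 * max L (sqrt S)) \<le> f (iterate it) - f (iterate it')"
proof -
  define G where "G = gnorm it"
  define w where "w = curv it"
  define W where "W = max L (sqrt S)"
  have w: "0 < w"
    unfolding w_def by (rule effective_curvature(2)[OF L])
  have W: "0 < W"
    using L by (auto simp: W_def)
  have G: "0 < G" "\<epsilon> \<le> G"
    using \<epsilon> by (auto simp: G_def)
  have \<sigma>: "0 < sigma it"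
    by (rule admissible_sigma_pos[OF adm])
  have "\<epsilon> * w \<le> G * W"
  proof -
    have "\<epsilon> * L \<le> G * W"
      using G L by (intro mult_mono) (auto simp: W_def)
    moreover have "\<epsilon> * sqrt (sigma it * G) \<le> G * W"
    proof -
      have "\<epsilon>\<^sup>2 * (sigma it * G) = \<epsilon> * G * (\<epsilon> * sigma it)"
        by (simp add: power2_eq_square mult.commute mult.left_commute)
      also have "\<dots> \<le> G * G * S"
        using G \<epsilon> S \<sigma> by (intro mult_mono) auto
      finally have "sqrt (\<epsilon>\<^sup>2 * (sigma it * G)) \<le> sqrt (G\<^sup>2 * S)"
        by (simp add: power2_eq_square)
      then have "\<epsilon> * sqrt (sigma it * G) \<le> G * sqrt S"
        using \<epsilon> G by (simp add: real_sqrt_mult)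
      also have "\<dots> \<le> G * W"
        using G by (intro mult_left_mono) (auto simp: W_def)
      finally show ?thesis .
    qed
    ultimately show ?thesis
      unfolding w_def effective_curvature_def G_def by (simp add: max_def)
  qed
  then have "\<epsilon> * (\<epsilon> * w) \<le> \<epsilon> * (G * W)"
    using \<epsilon> by simp
  also have "\<dots> \<le> G * (G * W)"
    using G W by (intro mult_right_mono) auto
  finally have "\<epsilon>\<^sup>2 / (6 * W) \<le> G\<^sup>2 / (6 * w)"
    using w W by (simp add: field_simps power2_eq_square)
  then have "eta1 p * (\<epsilon>\<^sup>2 / (6 * W)) \<le> eta1 p * (G\<^sup>2 / (6 * w))"
    using param_facts by (intro mult_left_mono) auto
  also have "\<dots> \<le> f (iterate it) - f (iterate it')"
    using decrease_if_successful[OF adm upd succ] by (simp add: G_def w_def)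
  finally show ?thesis
    by (simp add: W_def)
qed

section \<open>Runs of the algorithm\<close>

definition run :: "enat \<Rightarrow> (nat \<Rightarrow> 'n arc_iter) \<Rightarrow> bool" where
  "run M r \<longleftrightarrow> (\<forall>k. enat k < M \<longrightarrow> admissible (r k) \<and> arc_update p f (r k) (r (Suc k)))"

lemma runD:
  assumes "run M r" "enat k < M"
  shows "admissible (r k)" "arc_update p f (r k) (r (Suc k))"
  using assms unfolding run_def by auto

lemma infinite_runD:
  assumes "run \<infinity> r"
  shows "admissible (r k)" "arc_update p f (r k) (r (Suc k))"
  using assms unfolding run_def by auto

lemma run_shift: "run \<infinity> r \<Longrightarrow> run \<infinity> (\<lambda>k. r (m + k))"
  unfolding run_def by simp

lemma sigma_bound:
  assumes run: "run M r" and \<epsilon>: "0 < \<epsilon>" and n: "enat n \<le> M"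
    and large: "\<And>k. k < n \<Longrightarrow> \<epsilon> \<le> gnorm (r k)"
    and S: "\<epsilon> * sigma (r 0) \<le> S" "gamma3 p * success_threshold \<le> S"
  shows "k \<le> n \<Longrightarrow> \<epsilon> * sigma (r k) \<le> S"
proof (induction k)
  case 0
  show ?case
    by (rule S(1))
next
  case (Suc k)
  then have "enat k < M"
    using n by (meson Suc_le_lessD enat_ord_simps(2) less_le_trans)
  then show ?case
    using Suc large by (intro sigma_bound_step[OF runD[OF run] \<epsilon> _ _ S(2)]) auto
qed

lemma successful_count_bound:
  assumes run: "run M r" and \<epsilon>: "0 < \<epsilon>" and n: "enat n \<le> M"
    and large: "\<And>k. k < n \<Longrightarrow> \<epsilon> \<le> gnorm (r k)"
    and S: "\<epsilon> * sigma (r 0) \<le> S" "gamma3 p * success_threshold \<le> S"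
  shows "real (card {k. k < n \<and> successful p f (r k)}) * (eta1 p * \<epsilon>\<^sup>2 / (6 * max L (sqrt S)))
    \<le> f (iterate (r 0)) - f (iterate (r n))"
  (is "?count n * ?\<delta> \<le> _")
proof -
  have "m \<le> n \<Longrightarrow> ?count m * ?\<delta> \<le> f (iterate (r 0)) - f (iterate (r m))" for m
  proof (induction m)
    case 0
    show ?case
      by simp
  next
    case (Suc m)
    then have m: "enat m < M"
      using n by (meson Suc_le_lessD enat_ord_simps(2) less_le_trans)
    note adm = runD(1)[OF run m] and upd = runD(2)[OF run m]
    have IH: "?count m * ?\<delta> \<le> f (iterate (r 0)) - f (iterate (r m))"
      using Suc by simp
    show ?case
    proof (cases "successful p f (r m)")
      case True
      then have "{k. k < Suc m \<and> successful p f (r k)}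
          = insert m {k. k < m \<and> successful p f (r k)}"
        by (auto simp: less_Suc_eq)
      then have "?count (Suc m) = ?count m + 1"
        by simp
      moreover have "?\<delta> \<le> f (iterate (r m)) - f (iterate (r (Suc m)))"
        using Suc.prems large sigma_bound[OF run \<epsilon> n large S]
        by (intro decrease_at_large_gradient[OF adm upd True \<epsilon>]) auto
      ultimately show ?thesis
        using IH by (simp only: distrib_right)
    next
      case False
      then have "{k. k < Suc m \<and> successful p f (r k)} = {k. k < m \<and> successful p f (r k)}"
        by (auto simp: less_Suc_eq)
      then show ?thesis
        using IH iterate_monotone[OF adm upd] by simp
    qed
  qed
  then show ?thesis
    by simp
qed

text \<open>Discarding a step lowers the flag, and only a successful iteration can raise it again.\<close>

lemma eventually_never_discarded:
  assumes run: "run \<infinity> r" and unsucc: "\<And>k. m \<le> k \<Longrightarrow> \<not> successful p f (r k)"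
  obtains n where "m \<le> n" "\<And>k. n \<le> k \<Longrightarrow> \<not> discarded p f (r k)"
proof (cases "\<exists>k\<ge>m. discarded p f (r k)")
  case False
  then show thesis
    using that[of m] by auto
next
  case True
  then obtain n where n: "m \<le> n" "discarded p f (r n)"
    by blast
  have lowered: "\<not> flag (r k)" if "Suc n \<le> k" for k
    using that
  proof (induction k rule: dec_induct)
    case base
    then show ?case
      using infinite_runD(2)[OF run, of n] n(2) unfolding arc_update_def by simp
  next
    case (step k)
    then show ?case
      using infinite_runD(2)[OF run, of k] unsucc[of k] n(1)
      unfolding arc_update_def successful_def by (auto split: if_splits)
  qed
  show thesis
  proof (rule that)
    show "m \<le> Suc n"
      using n(1) by simp
    show "\<not> discarded p f (r k)" if "Suc n \<le> k" for k
      using lowered[OF that] unfolding discarded_def by simp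
  qed
qed

lemma function_values_converge:
  assumes run: "run \<infinity> r"
  obtains l where "(\<lambda>k. f (iterate (r k))) \<longlonglongrightarrow> l" and "\<And>k. l \<le> f (iterate (r k))"
proof -
  have dec: "decseq (\<lambda>k. f (iterate (r k)))"
    using iterate_monotone infinite_runD[OF run] by (intro decseq_SucI) simp
  have "\<forall>k. f_low \<le> f (iterate (r k))"
    using lower by blast
  then obtain l where "(\<lambda>k. f (iterate (r k))) \<longlonglongrightarrow> l" "\<forall>k. l \<le> f (iterate (r k))"
    by (rule decseq_convergent[OF dec])
  then show thesis
    by (intro that[of l]) auto
qed

lemma function_decrements_vanish:
  assumes "run \<infinity> r"
  shows "(\<lambda>k. f (iterate (r k)) - f (iterate (r (Suc k)))) \<longlonglongrightarrow> 0"
proof -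
  obtain l where l: "(\<lambda>k. f (iterate (r k))) \<longlonglongrightarrow> l"
    using function_values_converge[OF assms] by blast
  then have "(\<lambda>k. f (iterate (r k)) - f (iterate (r (Suc k)))) \<longlonglongrightarrow> l - l"
    by (intro tendsto_diff LIMSEQ_Suc)
  then show ?thesis
    by simp
qed

text \<open>Otherwise every successful iteration would lower the function by a fixed amount, so that from
  some iteration on all steps would be rejected, and the weight would grow geometrically; but it
  stays bounded.\<close>

lemma small_gradient_reached:
  assumes run: "run \<infinity> r" and \<epsilon>: "0 < \<epsilon>"
  shows "\<exists>k. gnorm (r k) < \<epsilon>"
proof (rule ccontr)
  assume "\<not> ?thesis"
  then have large: "\<epsilon> \<le> gnorm (r k)" for k
    by (simp add: not_less)
  define S where "S = \<epsilon> * sigma (r 0) + gamma3 p * success_threshold"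
  have \<sigma>: "0 < sigma (r k)" for k
    using admissible_sigma_pos infinite_runD(1)[OF run] by simp
  have S: "\<epsilon> * sigma (r 0) \<le> S" "gamma3 p * success_threshold \<le> S"
    using \<epsilon> \<sigma>[of 0] param_facts unfolding S_def success_threshold_def by auto
  have bounded: "\<epsilon> * sigma (r k) \<le> S" for k
    by (rule sigma_bound[OF run \<epsilon> _ large S, of k]) auto
  define \<delta> where "\<delta> = eta1 p * \<epsilon>\<^sup>2 / (6 * max L (sqrt S))"
  have "0 < \<delta>"
    unfolding \<delta>_def using \<epsilon> L param_facts by (intro divide_pos_pos mult_pos_pos) auto
  then have "\<forall>\<^sub>F k in sequentially. f (iterate (r k)) - f (iterate (r (Suc k))) < \<delta>"
    using function_decrements_vanish[OF run] by (simp add: order_tendstoD(2))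
  then obtain m where m: "\<And>k. m \<le> k \<Longrightarrow> f (iterate (r k)) - f (iterate (r (Suc k))) < \<delta>"
    unfolding eventually_sequentially by blast
  have unsucc: "\<not> successful p f (r k)" if "m \<le> k" for k
  proof
    assume "successful p f (r k)"
    then have "\<delta> \<le> f (iterate (r k)) - f (iterate (r (Suc k)))"
      unfolding \<delta>_def
      by (rule decrease_at_large_gradient[OF infinite_runD[OF run] _ \<epsilon> large bounded])
    with m[OF that] show False
      by simp
  qed
  obtain n where n: "m \<le> n" "\<And>k. n \<le> k \<Longrightarrow> \<not> discarded p f (r k)"
    using eventually_never_discarded[OF run unsucc] by blast
  have grow: "gamma2 p * sigma (r k) \<le> sigma (r (Suc k))" if "n \<le> k" for k
    using infinite_runD(2)[OF run, of k] unsucc[of k] n(1) n(2)[OF that] that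
    unfolding arc_update_def successful_def by (auto split: if_splits)
  have geometric: "gamma2 p ^ j * sigma (r n) \<le> sigma (r (n + j))" for j
  proof (induction j)
    case 0
    show ?case
      by simp
  next
    case (Suc j)
    then have "gamma2 p * (gamma2 p ^ j * sigma (r n)) \<le> gamma2 p * sigma (r (n + j))"
      using param_facts by (intro mult_left_mono) auto
    also have "\<dots> \<le> sigma (r (n + Suc j))"
      using grow[of "n + j"] by simp
    finally show ?case
      by (simp add: mult.assoc)
  qed
  obtain j where j: "S / (\<epsilon> * sigma (r n)) < gamma2 p ^ j"
    using real_arch_pow[OF param_facts(5)] by blast
  then have "S < gamma2 p ^ j * (\<epsilon> * sigma (r n))"
    using \<epsilon> \<sigma> by (simp add: divide_less_eq)
  also have "\<dots> = \<epsilon> * (gamma2 p ^ j * sigma (r n))"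
    by simp
  also have "\<dots> \<le> \<epsilon> * sigma (r (n + j))"
    using geometric \<epsilon> by (intro mult_left_mono) auto
  also have "\<dots> \<le> S"
    by (rule bounded)
  finally show False
    by simp
qed

text \<open>Suppose that the gradient norm is at least \<^term>\<open>2 * \<epsilon>\<close> at a late iterate \<^term>\<open>k\<close>, and let
  \<^term>\<open>l\<close> be the next one with norm below \<^term>\<open>\<epsilon>\<close>.  In between, each step is short relative to the
  decrease it achieves, and the total decrease from \<^term>\<open>k\<close> on is small.  So the iterates
  \<^term>\<open>k\<close> and \<^term>\<open>l\<close> are close, and their gradients cannot differ by \<^term>\<open>\<epsilon>\<close>.\<close>

lemma gradient_tendsto_zero:
  assumes run: "run \<infinity> r"
  shows "(\<lambda>k. gnorm (r k)) \<longlonglongrightarrow> 0"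
proof (rule LIMSEQ_I)
  fix e :: real
  assume e: "0 < e"
  define \<epsilon> where "\<epsilon> = e / 2"
  have \<epsilon>: "0 < \<epsilon>" and e_eq: "e = 2 * \<epsilon>"
    using e by (auto simp: \<epsilon>_def)
  define F where "F k = f (iterate (r k))" for k
  define A where "A = eta1 p * \<epsilon> / 18"
  have A: "0 < A"
    using \<epsilon> param_facts by (simp add: A_def)
  obtain l where l: "F \<longlonglongrightarrow> l" "\<And>k. l \<le> F k"
    using function_values_converge[OF run] unfolding F_def by blast
  have "0 < eta1 p * \<epsilon>\<^sup>2 / (6 * L)"
    using \<epsilon> L param_facts by (intro divide_pos_pos mult_pos_pos) auto
  then have "\<forall>\<^sub>F k in sequentially. F k - F (Suc k) < eta1 p * \<epsilon>\<^sup>2 / (6 * L)"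
    using function_decrements_vanish[OF run] unfolding F_def by (simp add: order_tendstoD(2))
  moreover have "\<forall>\<^sub>F k in sequentially. F k < l + A * \<epsilon> / L"
    using l(1) A \<epsilon> L by (intro order_tendstoD(2)) auto
  ultimately have "\<forall>\<^sub>F k in sequentially.
      F k - F (Suc k) < eta1 p * \<epsilon>\<^sup>2 / (6 * L) \<and> F k < l + A * \<epsilon> / L"
    by (rule eventually_conj)
  then obtain m where m: "\<And>k. m \<le> k \<Longrightarrow> F k - F (Suc k) < eta1 p * \<epsilon>\<^sup>2 / (6 * L)"
    "\<And>k. m \<le> k \<Longrightarrow> F k < l + A * \<epsilon> / L"
    unfolding eventually_sequentially by blast
  have "gnorm (r k) < e" if k: "m \<le> k" for k
  proof (rule ccontr)
    assume "\<not> gnorm (r k) < e"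
    then have big: "2 * \<epsilon> \<le> gnorm (r k)"
      by (simp add: e_eq)
    define d where "d = (LEAST d. gnorm (r (k + d)) < \<epsilon>)"
    have ex: "\<exists>d. gnorm (r (k + d)) < \<epsilon>"
      by (rule small_gradient_reached[OF run_shift[OF run] \<epsilon>])
    have small: "gnorm (r (k + d)) < \<epsilon>"
      unfolding d_def by (rule LeastI_ex[OF ex])
    have large: "\<epsilon> \<le> gnorm (r (k + j))" if "j < d" for j
      using not_less_Least[OF that[unfolded d_def]] by simp
    have "j \<le> d \<Longrightarrow> A * norm (iterate (r (k + j)) - iterate (r k)) \<le> F k - F (k + j)" for j
    proof (induction j)
      case 0
      show ?case
        by simp
    next
      case (Suc j)
      let ?a = "iterate (r (k + j)) - iterate (r k)"
      let ?b = "iterate (r (Suc (k + j))) - iterate (r (k + j))"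
      have "A * norm ?b \<le> F (k + j) - F (Suc (k + j))"
        using decrease_or_short_step[OF infinite_runD[OF run] \<epsilon> large, of j] Suc.prems
          m(1)[of "k + j"] k
        unfolding A_def F_def by (simp add: not_le[symmetric])
      moreover have "A * norm ?a \<le> F k - F (k + j)"
        using Suc by simp
      moreover have "A * norm (?a + ?b) \<le> A * norm ?a + A * norm ?b"
        using A norm_triangle_ineq[of ?a ?b]
        by (metis distrib_left mult_left_mono less_imp_le)
      ultimately show ?case
        by simp
    qed
    then have "A * norm (iterate (r (k + d)) - iterate (r k)) \<le> F k - F (k + d)"
      by simp
    also have "\<dots> < A * \<epsilon> / L"
      using m(2)[OF k] l(2)[of "k + d"] by linarith
    also have "\<dots> = A * (\<epsilon> / L)"
      by simp
    finally have "norm (iterate (r (k + d)) - iterate (r k)) < \<epsilon> / L"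
      using A by (simp only: mult_less_cancel_left_pos)
    then have "L * norm (iterate (r (k + d)) - iterate (r k)) < \<epsilon>"
      using L by (simp add: less_divide_eq mult.commute)
    then have "norm (grad f (iterate (r (k + d))) - grad f (iterate (r k))) < \<epsilon>"
      using lipschitz by (rule le_less_trans[rotated])
    then have "gnorm (r k) < gnorm (r (k + d)) + \<epsilon>"
      using norm_triangle_ineq2[of "grad f (iterate (r k))" "grad f (iterate (r (k + d)))"]
      by (simp add: norm_minus_commute)
    with big small show False
      by simp
  qed
  then show "\<exists>m. \<forall>k\<ge>m. norm (gnorm (r k) - 0) < e"
    by auto
qed

lemma steps_tendsto_zero:
  assumes run: "run \<infinity> r"
  shows "(\<lambda>k. norm (iterate (r (Suc k)) - iterate (r k))) \<longlonglongrightarrow> 0"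
proof -
  let ?s = "\<lambda>k. norm (iterate (r (Suc k)) - iterate (r k))"
  define c where "c = eta1 p * sigma_min p / 3"
  have c: "0 < c"
    using param_facts by (simp add: c_def)
  let ?d = "\<lambda>k. (f (iterate (r k)) - f (iterate (r (Suc k)))) / c"
  have le: "?s k ^ 3 \<le> ?d k" for k
    using decrease_ge_cube[OF infinite_runD[OF run], of k] c
    by (simp add: c_def pos_le_divide_eq mult.commute)
  have "?d \<longlonglongrightarrow> 0 / c"
    using c by (intro tendsto_divide function_decrements_vanish[OF run] tendsto_const) simp
  then have "?d \<longlonglongrightarrow> 0"
    by simp
  then have "(\<lambda>k. ?s k ^ 3) \<longlonglongrightarrow> 0"
  proof (rule tendsto_sandwich[OF _ _ tendsto_const, rotated 2])
    show "\<forall>\<^sub>F k in sequentially. 0 \<le> ?s k ^ 3"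
      by (rule always_eventually) simp
    show "\<forall>\<^sub>F k in sequentially. ?s k ^ 3 \<le> ?d k"
      using le by (intro always_eventually allI)
  qed
  then have "(\<lambda>k. root 3 (?s k ^ 3)) \<longlonglongrightarrow> root 3 0"
    by (rule tendsto_real_root)
  moreover have "root 3 (?s k ^ 3) = ?s k" for k
    by (rule real_root_power_cancel) simp_all
  ultimately show ?thesis
    by simp
qed

lemma grad_continuous: "continuous_on UNIV (grad f)"
proof -
  have "L-lipschitz_on UNIV (grad f)"
    using lipschitz L by (intro lipschitz_onI) (auto simp: dist_norm)
  then show ?thesis
    by (rule lipschitz_on_continuous_on)
qed

lemma accumulation_point_stationary:
  assumes run: "run \<infinity> r" and j: "strict_mono j" and lim: "(\<lambda>i. iterate (r (j i))) \<longlonglongrightarrow> x"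
  shows "grad f x = 0"
proof -
  have "isCont (grad f) x"
    using grad_continuous by (simp add: continuous_on_eq_continuous_at)
  then have "(\<lambda>i. norm (grad f (iterate (r (j i))))) \<longlonglongrightarrow> norm (grad f x)"
    by (intro tendsto_norm isCont_tendsto_compose[OF _ lim])
  moreover have "(\<lambda>i. norm (grad f (iterate (r (j i))))) \<longlonglongrightarrow> 0"
    using LIMSEQ_subseq_LIMSEQ[OF gradient_tendsto_zero[OF run] j] by (simp add: o_def)
  ultimately have "norm (grad f x) = 0"
    by (rule LIMSEQ_unique)
  then show ?thesis
    by simp
qed

end

section \<open>The subsampled algorithm\<close>

context arc_analysis
begin

text \<open>The decrease that is available, divided by the decrease that each successful iteration
  guarantees until the tolerance is met.\<close>

definition success_bound :: "real^'n \<Rightarrow> real \<Rightarrow> real" where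
  "success_bound x0 \<epsilon> = (f x0 - f_low) *
     (6 * max L (sqrt (\<epsilon> * \<sigma>0 + gamma3 p * success_threshold))) / (eta1 p * \<epsilon>\<^sup>2)"

lemma threshold_nonneg: "0 \<le> gamma3 p * success_threshold"
  using param_facts by (simp add: success_threshold_def)

lemma sigma0_pos: "0 < \<sigma>0"
  using params unfolding valid_params_def by linarith

lemma success_bound_bigo: "success_bound x0 \<in> O[at_right 0](\<lambda>\<epsilon>. 1 / \<epsilon> ^ 2)"
proof (rule bigoI)
  define W where "W \<epsilon> = max L (sqrt (\<epsilon> * \<sigma>0 + gamma3 p * success_threshold))" for \<epsilon>
  \<comment> \<open>\<^term>\<open>W\<close> increases, so for tolerances below 1 its value at 1 serves as a constant.\<close>
  define c where "c = (f x0 - f_low) * (6 * W 1) / eta1 p"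
  have "norm (success_bound x0 \<epsilon>) \<le> c * norm (1 / \<epsilon>\<^sup>2)" if "0 < \<epsilon>" "\<epsilon> < 1" for \<epsilon>
  proof -
    have nonneg: "0 \<le> f x0 - f_low" "0 \<le> W \<epsilon>"
      using lower L by (auto simp: W_def)
    have "\<epsilon> * \<sigma>0 \<le> 1 * \<sigma>0"
      using that sigma0_pos by (intro mult_right_mono) auto
    then have "sqrt (\<epsilon> * \<sigma>0 + gamma3 p * success_threshold)
        \<le> sqrt (1 * \<sigma>0 + gamma3 p * success_threshold)"
      by simp
    then have "W \<epsilon> \<le> W 1"
      unfolding W_def by (rule max.mono[OF order_refl])
    then have "(f x0 - f_low) * (6 * W \<epsilon>) / (eta1 p * \<epsilon>\<^sup>2)
        \<le> (f x0 - f_low) * (6 * W 1) / (eta1 p * \<epsilon>\<^sup>2)"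
      using nonneg param_facts by (intro divide_right_mono mult_left_mono) auto
    moreover have "success_bound x0 \<epsilon> = (f x0 - f_low) * (6 * W \<epsilon>) / (eta1 p * \<epsilon>\<^sup>2)"
      by (simp add: success_bound_def W_def)
    moreover have "0 \<le> (f x0 - f_low) * (6 * W \<epsilon>) / (eta1 p * \<epsilon>\<^sup>2)"
      using nonneg param_facts by (intro divide_nonneg_nonneg mult_nonneg_nonneg) auto
    moreover have "(f x0 - f_low) * (6 * W 1) / (eta1 p * \<epsilon>\<^sup>2) = c * norm (1 / \<epsilon>\<^sup>2)"
      by (simp add: c_def)
    ultimately show ?thesis
      by simp
  qed
  then show "\<forall>\<^sub>F \<epsilon> in at_right 0. norm (success_bound x0 \<epsilon>) \<le> c * norm (1 / \<epsilon> ^ 2)"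
    unfolding eventually_at_right_field by (intro exI[of _ 1]) auto
qed

lemma tolerance_met:
  assumes run: "run M r" and start: "iterate (r 0) = x0" "sigma (r 0) = \<sigma>0"
    and \<epsilon>: "0 < \<epsilon>" and stop: "stopped_at f \<epsilon> M r"
  shows "\<exists>m. M = enat m \<and> gnorm (r m) < \<epsilon> \<and>
    real (card {k. k < m \<and> successful p f (r k)}) \<le> success_bound x0 \<epsilon>"
proof (cases M)
  case infinity
  then show ?thesis
    using small_gradient_reached[OF _ \<epsilon>] run stop unfolding stopped_at_def by auto
next
  case (enat m)
  define S where "S = \<epsilon> * \<sigma>0 + gamma3 p * success_threshold"
  have large: "\<epsilon> \<le> gnorm (r k)" if "k < m" for k
    using stop enat that unfolding stopped_at_def by (auto simp: not_less)
  have S: "\<epsilon> * sigma (r 0) \<le> S" "gamma3 p * success_threshold \<le> S"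
    using start threshold_nonneg sigma0_pos \<epsilon> by (auto simp: S_def)
  have "real (card {k. k < m \<and> successful p f (r k)}) * (eta1 p * \<epsilon>\<^sup>2 / (6 * max L (sqrt S)))
      \<le> f (iterate (r 0)) - f (iterate (r m))"
    using enat by (intro successful_count_bound[OF run \<epsilon> _ large S]) auto
  also have "\<dots> \<le> f x0 - f_low"
    using lower start by simp
  finally have "real (card {k. k < m \<and> successful p f (r k)}) \<le> success_bound x0 \<epsilon>"
    using \<epsilon> L param_facts by (simp add: success_bound_def S_def[symmetric] pos_le_divide_eq
        pos_divide_le_eq less_max_iff_disj)
  then show ?thesis
    using enat stop unfolding stopped_at_def by auto
qed

lemma converges_to_nondegenerate_minimiser:
  assumes run: "run \<infinity> r" and f: "twice_differentiable f"
    and j: "strict_mono j" and lim: "(\<lambda>i. iterate (r (j i))) \<longlonglongrightarrow> x"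
    and pd: "pos_def (hessian f x)"
  shows "(\<lambda>k. iterate (r k)) \<longlonglongrightarrow> x"
proof -
  obtain \<delta> where \<delta>: "0 < \<delta>" "\<And>y. norm (y - x) \<le> \<delta> \<Longrightarrow> grad f y = 0 \<Longrightarrow> y = x"
    using isolated_zero_of_pos_def_derivative[OF grad_has_derivative_hessian[OF f] pd
        accumulation_point_stationary[OF run j lim]] by blast
  show ?thesis
  proof (rule tendsto_isolated_zero[OF grad_continuous \<delta>(1) _ gradient_tendsto_zero[OF run] _ j lim])
    show "y = x" if "dist y x \<le> \<delta>" "grad f y = 0" for y
      using \<delta>(2) that by (simp add: dist_norm)
    show "(\<lambda>k. dist (iterate (r (Suc k))) (iterate (r k))) \<longlonglongrightarrow> 0"
      using steps_tendsto_zero[OF run] by (simp add: dist_norm)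
  qed
qed

lemma sigma_min_preserved:
  assumes "arc_update p f it it'" "sigma_min p \<le> sigma it"
  shows "sigma_min p \<le> sigma it'"
proof -
  have "sigma it \<le> gamma2 p * sigma it"
    using assms(2) param_facts by simp
  then show ?thesis
    using assms unfolding arc_update_def by (auto split: if_splits)
qed

lemma run_if_arc_iterations:
  assumes hess: "\<And>i x. i \<in> {1..N} \<Longrightarrow> matrix_norm (hessian (\<phi> i) x) \<le> L"
    and iter: "arc_iterations p \<phi> N f x0 \<sigma>0 M r" and cauchy: "cauchy_condition f M r"
  shows "run M r"
  unfolding run_def
proof (intro allI impI conjI)
  fix k
  assume k: "enat k < M"
  have "sigma_min p \<le> sigma (r k)"
    using k
  proof (induction k)
    case 0
    show ?case
      using iter params unfolding arc_iterations_def valid_params_def by simp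
  next
    case (Suc k)
    then have "enat k < M"
      by (meson enat_ord_simps(2) lessI less_trans)
    then show ?case
      using Suc iter sigma_min_preserved unfolding arc_iterations_def by blast
  qed
  moreover have sampled: "sampled_hessian \<phi> N (r k)" and "trial_step_ok p f (r k)"
    and upd: "arc_update p f (r k) (r (Suc k))"
    using iter k unfolding arc_iterations_def by auto
  moreover have "curvature_bounded L (hess_approx (r k))"
  proof -
    have "finite (sample (r k))"
      using sampled finite_subset unfolding sampled_hessian_def by blast
    then show ?thesis
      using sampled average_curvature_bounded[of "sample (r k)" "\<lambda>i. hessian (\<phi> i) (iterate (r k))" L]
        hess unfolding sampled_hessian_def by (metis subsetD)
  qed
  ultimately show "admissible (r k)"
    using cauchy k unfolding admissible_def cauchy_condition_def by blast
  show "arc_update p f (r k) (r (Suc k))"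
    by (rule upd)
qed

end

lemma average_grad_lipschitz:
  fixes \<phi> :: "nat \<Rightarrow> real^'n \<Rightarrow> real"
  assumes N: "1 \<le> N" and \<phi>: "\<And>i. i \<in> {1..N} \<Longrightarrow> twice_differentiable (\<phi> i)"
    and hess: "\<And>i x. i \<in> {1..N} \<Longrightarrow> matrix_norm (hessian (\<phi> i) x) \<le> L"
  shows "norm (grad (\<lambda>x. 1 / real N * (\<Sum>i=1..N. \<phi> i x)) y
      - grad (\<lambda>x. 1 / real N * (\<Sum>i=1..N. \<phi> i x)) x) \<le> L * norm (y - x)"
proof -
  have grad: "grad (\<lambda>x. 1 / real N * (\<Sum>i=1..N. \<phi> i x)) z
      = (1 / real N) *\<^sub>R (\<Sum>i=1..N. grad (\<phi> i) z)" for z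
    using \<phi> unfolding twice_differentiable_def by (intro grad_average) blast
  have "norm (\<Sum>i=1..N. grad (\<phi> i) y - grad (\<phi> i) x) \<le> (\<Sum>i=1..N. L * norm (y - x))"
    using grad_lipschitz[OF \<phi> hess] by (intro sum_norm_le) blast
  then have "norm (\<Sum>i=1..N. grad (\<phi> i) y - grad (\<phi> i) x) / real N \<le> L * norm (y - x)"
    using N by (simp add: divide_le_eq mult.commute)
  then show ?thesis
    unfolding grad by (simp add: scaleR_diff_right[symmetric] sum_subtractf)
qed

theorem theorem6p2:
  fixes \<phi> :: "nat \<Rightarrow> real^'n \<Rightarrow> real" and f :: "real^'n \<Rightarrow> real" and N :: nat
    and f_low \<kappa>_bar \<sigma>0 :: real and \<kappa> :: "real^'n \<Rightarrow> real" and x0 :: "real^'n"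
    and p :: arc_params
  assumes N: "N \<ge> 1"
    and f_def: "f = (\<lambda>x. 1 / real N * (\<Sum>i=1..N. \<phi> i x))"
    and \<phi>_diff: "\<And>i. i \<in> {1..N} \<Longrightarrow> twice_differentiable (\<phi> i)"
    and f_C2: "C2 f"
    and f_bounded: "\<And>x. f_low \<le> f x"
    and \<kappa>_nonneg: "\<And>x. 0 \<le> \<kappa> x"
    and \<kappa>: "\<And>x. (MAX i\<in>{1..N}. matrix_norm (hessian (\<phi> i) x)) \<le> \<kappa> x"
    and \<kappa>_bar_nonneg: "0 \<le> \<kappa>_bar"
    and \<kappa>_bar: "\<And>x. \<kappa> x \<le> \<kappa>_bar"
    and params: "valid_params p \<sigma>0"
  shows
    "(\<exists>bound :: real \<Rightarrow> real.
        bound \<in> O[at_right 0](\<lambda>\<epsilon>. 1 / \<epsilon>^2) \<and>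
        (\<forall>\<epsilon>>0. \<forall>M r.
           arc_iterations p \<phi> N f x0 \<sigma>0 M r \<and> stopped_at f \<epsilon> M r \<and> cauchy_condition f M r \<longrightarrow>
           (\<exists>m. M = enat m \<and> norm (grad f (iterate (r m))) < \<epsilon> \<and>
                real (card {k. k < m \<and> successful p f (r k)}) \<le> bound \<epsilon>)))
     \<and>
     (\<forall>r. arc_iterations p \<phi> N f x0 \<sigma>0 \<infinity> r \<and> cauchy_condition f \<infinity> r \<longrightarrow>
        (\<lambda>k. norm (grad f (iterate (r k)))) \<longlonglongrightarrow> 0 \<and>
        (\<forall>j xs. strict_mono (j :: nat \<Rightarrow> nat) \<and> (\<lambda>i. iterate (r (j i))) \<longlonglongrightarrow> xs \<longrightarrow>
                grad f xs = 0))
     \<and>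
     (\<forall>r. arc_iterations p \<phi> N f x0 \<sigma>0 \<infinity> r \<and> cauchy_condition f \<infinity> r \<longrightarrow>
        (\<forall>j xs. strict_mono (j :: nat \<Rightarrow> nat) \<and> (\<lambda>i. iterate (r (j i))) \<longlonglongrightarrow> xs \<and>
                pos_def (hessian f xs) \<longrightarrow>
                (\<lambda>k. iterate (r k)) \<longlonglongrightarrow> xs))"
proof -
  define L where "L = 1 + \<kappa>_bar"
  have hess: "matrix_norm (hessian (\<phi> i) x) \<le> L" if "i \<in> {1..N}" for i x
  proof -
    have "matrix_norm (hessian (\<phi> i) x) \<le> (MAX i\<in>{1..N}. matrix_norm (hessian (\<phi> i) x))"
      using that by (intro Max_ge) auto
    then show ?thesis
      using \<kappa>[of x] \<kappa>_bar[of x] by (simp add: L_def)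
  qed
  have f2: "twice_differentiable f"
    using f_C2 by (simp add: C2_def)
  interpret arc_analysis p \<sigma>0 f L f_low
  proof
    show "valid_params p \<sigma>0"
      by (rule params)
    show "1 \<le> L"
      using \<kappa>_bar_nonneg by (simp add: L_def)
    show "f differentiable (at x)" for x
      using f2 by (simp add: twice_differentiable_def)
    show "norm (grad f y - grad f x) \<le> L * norm (y - x)" for x y
      unfolding f_def by (rule average_grad_lipschitz[OF N \<phi>_diff hess])
    show "f_low \<le> f x" for x
      by (rule f_bounded)
  qed
  have run: "run M r" if "arc_iterations p \<phi> N f x0 \<sigma>0 M r" "cauchy_condition f M r" for M r
    by (rule run_if_arc_iterations[OF _ that]) (rule hess)
  have complexity: "\<exists>m. M = enat m \<and> norm (grad f (iterate (r m))) < \<epsilon> \<and>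
      real (card {k. k < m \<and> successful p f (r k)}) \<le> success_bound x0 \<epsilon>"
    if "0 < \<epsilon>" "arc_iterations p \<phi> N f x0 \<sigma>0 M r" "stopped_at f \<epsilon> M r" "cauchy_condition f M r"
    for \<epsilon> M r
  proof (rule tolerance_met)
    show "run M r"
      using that by (intro run)
    show "iterate (r 0) = x0" "sigma (r 0) = \<sigma>0"
      using that(2) by (auto simp: arc_iterations_def)
  qed (use that in auto)
  show ?thesis
  proof (intro conjI)
    show "\<exists>bound. bound \<in> O[at_right 0](\<lambda>\<epsilon>. 1 / \<epsilon>^2) \<and>
        (\<forall>\<epsilon>>0. \<forall>M r.
           arc_iterations p \<phi> N f x0 \<sigma>0 M r \<and> stopped_at f \<epsilon> M r \<and> cauchy_condition f M r \<longrightarrow>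
           (\<exists>m. M = enat m \<and> norm (grad f (iterate (r m))) < \<epsilon> \<and>
                real (card {k. k < m \<and> successful p f (r k)}) \<le> bound \<epsilon>))"
      using success_bound_bigo complexity by blast
  next
    show "\<forall>r. arc_iterations p \<phi> N f x0 \<sigma>0 \<infinity> r \<and> cauchy_condition f \<infinity> r \<longrightarrow>
        (\<lambda>k. norm (grad f (iterate (r k)))) \<longlonglongrightarrow> 0 \<and>
        (\<forall>j xs. strict_mono (j :: nat \<Rightarrow> nat) \<and> (\<lambda>i. iterate (r (j i))) \<longlonglongrightarrow> xs \<longrightarrow>
                grad f xs = 0)"
      using run gradient_tendsto_zero accumulation_point_stationary by blast
  next
    show "\<forall>r. arc_iterations p \<phi> N f x0 \<sigma>0 \<infinity> r \<and> cauchy_condition f \<infinity> r \<longrightarrow>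
        (\<forall>j xs. strict_mono (j :: nat \<Rightarrow> nat) \<and> (\<lambda>i. iterate (r (j i))) \<longlonglongrightarrow> xs \<and>
                pos_def (hessian f xs) \<longrightarrow>
                (\<lambda>k. iterate (r k)) \<longlonglongrightarrow> xs)"
      using run converges_to_nondegenerate_minimiser[OF _ f2] by blast
  qed
qed

end
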